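(* Let $2\le k\le n$ and let $D$ be a strong digraph of order $n$. Then $1\le \lambda_k(D)\le n-1$. Moreover, both bounds are sharp, and $\lambda_k(D)=n-1$ holds if and only if $D\cong\overleftrightarrow{K}_n$ and either $k\notin\{4,6\}$, or $k\in\{4,6\}$ and $k<n$.
   Context: Digraphs are finite, without loops or parallel arcs; strong means strongly connected. $\overleftrightarrow{K}_n$ is the complete digraph on $n$ vertices. For $S\subseteq V(D)$, $\lambda_S(D)$ is the maximum number of pairwise arc-disjoint strong subgraphs of $D$ containing $S$, and $\lambda_k(D)=\min\{\lambda_S(D): S\subseteq V(D), |S|=k\}$. *)

theory Defs
  imports Main
begin

text \<open>A digraph is a pair (V, A): a finite vertex set and a set of arcs,
  without loops (parallel arcs are excluded automatically since A is a set).\<close>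
definition digraph :: "'a set \<Rightarrow> ('a \<times> 'a) set \<Rightarrow> bool" where
  "digraph V A \<longleftrightarrow> finite V \<and> A \<subseteq> V \<times> V \<and> (\<forall>v. (v, v) \<notin> A)"

definition strong :: "'a set \<Rightarrow> ('a \<times> 'a) set \<Rightarrow> bool" where
  "strong V A \<longleftrightarrow> (\<forall>u\<in>V. \<forall>v\<in>V. (u, v) \<in> A\<^sup>*)"

text \<open>H = (V', A') is a strong subgraph of D = (V, A) containing S.\<close>
definition strong_subgraph_containing ::
  "'a set \<Rightarrow> ('a \<times> 'a) set \<Rightarrow> 'a set \<Rightarrow> 'a set \<times> ('a \<times> 'a) set \<Rightarrow> bool" where
  "strong_subgraph_containing V A S H \<longleftrightarrow>
     fst H \<subseteq> V \<and> snd H \<subseteq> A \<and> snd H \<subseteq> fst H \<times> fst H \<and>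
     strong (fst H) (snd H) \<and> S \<subseteq> fst H"

text \<open>lambda_S(D): maximum number of pairwise arc-disjoint strong subgraphs containing S.\<close>
definition lambda_S :: "'a set \<Rightarrow> ('a \<times> 'a) set \<Rightarrow> 'a set \<Rightarrow> nat" where
  "lambda_S V A S = Max {m. \<exists>H :: nat \<Rightarrow> 'a set \<times> ('a \<times> 'a) set.
      (\<forall>i<m. strong_subgraph_containing V A S (H i)) \<and>
      (\<forall>i<m. \<forall>j<m. i \<noteq> j \<longrightarrow> snd (H i) \<inter> snd (H j) = {})}"

definition lambda_k :: "'a set \<Rightarrow> ('a \<times> 'a) set \<Rightarrow> nat \<Rightarrow> nat" where
  "lambda_k V A k = Min {lambda_S V A S | S. S \<subseteq> V \<and> card S = k}"

text \<open>The complete digraph on n vertices, with vertex set {0..<n}.\<close>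
definition complete_digraph_V :: "nat \<Rightarrow> nat set" where
  "complete_digraph_V n = {0..<n}"

definition complete_digraph_A :: "nat \<Rightarrow> (nat \<times> nat) set" where
  "complete_digraph_A n = {(u, v). u < n \<and> v < n \<and> u \<noteq> v}"

definition digraph_iso ::
  "'a set \<Rightarrow> ('a \<times> 'a) set \<Rightarrow> 'b set \<Rightarrow> ('b \<times> 'b) set \<Rightarrow> bool" where
  "digraph_iso V A W B \<longleftrightarrow> (\<exists>f. bij_betw f V W \<and>
      (\<forall>u\<in>V. \<forall>v\<in>V. (u, v) \<in> A \<longleftrightarrow> (f u, f v) \<in> B))"

end

theory Submission
  imports Defs
begin

text \<open>Every strong subgraph containing \<open>S\<close> uses an arc out of each vertex of \<open>S\<close>, so
  \<open>\<lambda>\<^sub>S\<close> is bounded by outdegrees; this gives the upper bound and forces extremal digraphs to be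
  complete. For \<open>k = n\<close>, equality in the complete digraph amounts to a decomposition of its arcs into
  \<open>n - 1\<close> Hamiltonian cycles, which exists unless \<open>n \<in> {4, 6}\<close> (Tillson's theorem).

  For odd \<open>n = 2t + 1\<close> rotate Walecki's zigzag \<open>\<infinity>, 0, 1, -1, 2, -2, \<dots>, t\<close> through \<open>\<int>/2t\<close>. For even
  \<open>n = 2t + 2 \<ge> 8\<close> this decomposition on \<open>2t + 1\<close> vertices has a Hamiltonian path meeting each of the
  \<open>2t\<close> cycles in exactly one arc, namely the path with steps \<open>x \<mapsto> x - 2\<close> except for
  \<open>2 \<mapsto> -2\<close>, \<open>t \<mapsto> t - 1\<close>, \<open>1 \<mapsto> 0\<close>, \<open>0 \<mapsto> -1\<close> and \<open>t + 1 \<mapsto> \<infinity>\<close>. Inserting a new vertex \<open>a\<close> into that arc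
  of each cycle and closing the path up through \<open>a\<close> yields \<open>2t + 1\<close> Hamiltonian cycles on \<open>2t + 2\<close>
  vertices. For \<open>k < n \<in> {4, 6}\<close> the odd case on \<open>n - 1\<close> vertices and a star at the remaining vertex
  suffice; for \<open>k = n \<in> {4, 6}\<close> a finite search, with one cycle normalised to \<open>0, 1, \<dots>, n - 1\<close>, rules out
  a decomposition.\<close>

section \<open>Packings and outdegrees\<close>

definition packing :: "'a set \<Rightarrow> ('a \<times> 'a) set \<Rightarrow> 'a set \<Rightarrow> nat \<Rightarrow> bool" where
  "packing V A S m \<longleftrightarrow> (\<exists>H :: nat \<Rightarrow> 'a set \<times> ('a \<times> 'a) set.
      (\<forall>i<m. strong_subgraph_containing V A S (H i)) \<and>
      (\<forall>i<m. \<forall>j<m. i \<noteq> j \<longrightarrow> snd (H i) \<inter> snd (H j) = {}))"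

lemma lambda_S_eq: "lambda_S V A S = Max {m. packing V A S m}"
  unfolding lambda_S_def packing_def ..

lemma strong_out_arc:
  assumes "strong V A" "v \<in> V" "w \<in> V" "v \<noteq> w"
  obtains y where "(v, y) \<in> A"
proof -
  have "(v, w) \<in> A\<^sup>*" using assms by (auto simp: strong_def)
  then show thesis using assms(4) that by (cases rule: converse_rtranclE) auto
qed

lemma other_element:
  assumes "2 \<le> card S" "v \<in> S"
  obtains w where "w \<in> S" "w \<noteq> v"
proof -
  have "card {v} < card S" using assms by simp
  then have "\<not> S \<subseteq> {v}" using card_mono[of "{v}" S] by auto
  then show thesis using that by blast
qed

text \<open>Two points in \<open>S\<close> rule out arcless one-vertex subgraphs, so each subgraph
  has an arc out of \<open>v\<close>; arc-disjointness makes the chosen heads distinct.\<close>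

lemma packing_le_outdegree:
  assumes "finite A" "packing V A S m" "2 \<le> card S" "v \<in> S"
  shows "m \<le> card (A `` {v})"
proof -
  obtain H where H: "\<And>i. i < m \<Longrightarrow> strong_subgraph_containing V A S (H i)"
    and D: "\<And>i j. i < m \<Longrightarrow> j < m \<Longrightarrow> i \<noteq> j \<Longrightarrow> snd (H i) \<inter> snd (H j) = {}"
    using assms(2) unfolding packing_def by blast
  obtain w where w: "w \<in> S" "w \<noteq> v" using other_element assms(3,4) by metis
  have "\<exists>y. (v, y) \<in> snd (H i)" if "i < m" for i
  proof -
    have "strong (fst (H i)) (snd (H i))" "v \<in> fst (H i)" "w \<in> fst (H i)"
      using H[OF that] assms(4) w by (auto simp: strong_subgraph_containing_def)
    then show ?thesis using w strong_out_arc by metis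
  qed
  then obtain y where y: "\<And>i. i < m \<Longrightarrow> (v, y i) \<in> snd (H i)" by metis
  have "inj_on y {..<m}"
    by (rule inj_onI) (use y D in \<open>fastforce\<close>)
  moreover have "y ` {..<m} \<subseteq> A `` {v}"
    using y H by (fastforce simp: strong_subgraph_containing_def)
  moreover have "finite (A `` {v})" using assms(1) by (rule finite_Image)
  ultimately show ?thesis using card_inj_on_le[of y "{..<m}" "A `` {v}"] by simp
qed

text \<open>Packing sizes are bounded by an outdegree and the empty packing has size 0, so the
  \<open>Max\<close> defining \<open>lambda_S\<close> is a genuine, attained maximum.\<close>

lemma
  assumes "finite A" "2 \<le> card S"
  shows packing_lambda_S: "packing V A S (lambda_S V A S)"
    and lambda_S_ge: "packing V A S m \<Longrightarrow> m \<le> lambda_S V A S"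
proof -
  obtain v where "v \<in> S" using assms(2) by fastforce
  then have "{m. packing V A S m} \<subseteq> {..card (A `` {v})}"
    using packing_le_outdegree[OF assms(1) _ assms(2)] by blast
  then have fin: "finite {m. packing V A S m}" using finite_subset by blast
  have "0 \<in> {m. packing V A S m}" by (simp add: packing_def)
  then show "packing V A S (lambda_S V A S)"
    using Max_in[OF fin] unfolding lambda_S_eq by blast
  show "m \<le> lambda_S V A S" if "packing V A S m"
    using Max_ge[OF fin] that unfolding lambda_S_eq by blast
qed

lemma lambda_S_le_outdegree:
  assumes "finite A" "2 \<le> card S" "v \<in> S"
  shows "lambda_S V A S \<le> card (A `` {v})"
  using packing_le_outdegree packing_lambda_S assms by metis

lemma
  assumes "finite V" "k \<le> card V"
  shows lambda_k_attained: "\<exists>S\<subseteq>V. card S = k \<and> lambda_k V A k = lambda_S V A S"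
    and lambda_k_le: "S \<subseteq> V \<Longrightarrow> card S = k \<Longrightarrow> lambda_k V A k \<le> lambda_S V A S"
proof -
  let ?L = "{lambda_S V A S | S. S \<subseteq> V \<and> card S = k}"
  have "?L \<subseteq> lambda_S V A ` Pow V" by auto
  then have fin: "finite ?L" using assms(1) finite_subset by blast
  have "\<exists>S. S \<subseteq> V \<and> card S = k" using obtain_subset_with_card_n[OF assms(2)] by metis
  then have "?L \<noteq> {}" by blast
  then have "Min ?L \<in> ?L" using fin by (rule Min_in[rotated])
  then show "\<exists>S\<subseteq>V. card S = k \<and> lambda_k V A k = lambda_S V A S"
    unfolding lambda_k_def by auto
  show "lambda_k V A k \<le> lambda_S V A S" if "S \<subseteq> V" "card S = k"
    unfolding lambda_k_def using Min_le[OF fin] that by blast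
qed

lemma digraph_finite_arcs: "digraph V A \<Longrightarrow> finite A"
  unfolding digraph_def using finite_subset[of A "V \<times> V"] by blast

lemma digraph_out_subset: "digraph V A \<Longrightarrow> A `` {v} \<subseteq> V - {v}"
  unfolding digraph_def by blast

text \<open>Each vertex \<open>v\<close> lies in some \<open>k\<close>-set, and the minimum over all
  \<open>k\<close>-sets is at most the value at that one.\<close>

lemma lambda_k_le_outdegree:
  assumes "digraph V A" "2 \<le> k" "k \<le> card V" "v \<in> V"
  shows "lambda_k V A k \<le> card (A `` {v})"
proof -
  have fin: "finite V" using assms(1) by (simp add: digraph_def)
  have "k - 1 \<le> card (V - {v})" using assms fin by simp
  then obtain T where T: "T \<subseteq> V - {v}" "card T = k - 1" "finite T"
    using obtain_subset_with_card_n by metis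
  then have S: "insert v T \<subseteq> V" "card (insert v T) = k"
    using assms by (auto simp: card_insert_if)
  show ?thesis
    using lambda_k_le[OF fin assms(3) S, of A]
      lambda_S_le_outdegree[OF digraph_finite_arcs[OF assms(1)], of "insert v T" v V] S assms(2)
    by simp
qed

lemma lambda_k_le_order:
  assumes "digraph V A" "2 \<le> k" "k \<le> card V"
  shows "lambda_k V A k \<le> card V - 1"
proof -
  have fin: "finite V" using assms(1) by (simp add: digraph_def)
  obtain v where v: "v \<in> V" using assms by fastforce
  have "card (A `` {v}) \<le> card V - 1"
    using card_mono[OF _ digraph_out_subset[OF assms(1)], of v] fin v by simp
  then show ?thesis using lambda_k_le_outdegree[OF assms v] by simp
qed

lemma lambda_k_ge_one:
  assumes "digraph V A" "strong V A" "2 \<le> k" "k \<le> card V"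
  shows "1 \<le> lambda_k V A k"
proof -
  have fin: "finite V" using assms(1) by (simp add: digraph_def)
  obtain S where S: "S \<subseteq> V" "card S = k" "lambda_k V A k = lambda_S V A S"
    using lambda_k_attained[OF fin assms(4)] by blast
  have "packing V A S 1" unfolding packing_def
    using assms S(1)
    by (intro exI[of _ "\<lambda>_. (V, A)"]) (auto simp: strong_subgraph_containing_def digraph_def)
  then show ?thesis using S lambda_S_ge[OF digraph_finite_arcs[OF assms(1)]] assms(3) by metis
qed

text \<open>Equality forces every outdegree up to \<open>card V - 1\<close>, so each vertex has arcs
  to all others.\<close>

lemma lambda_k_extremal_complete:
  assumes "digraph V A" "2 \<le> k" "k \<le> card V" "lambda_k V A k = card V - 1"
  shows "A = V \<times> V - Id"
proof
  show "A \<subseteq> V \<times> V - Id" using assms(1) by (auto simp: digraph_def)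
  have fin: "finite V" using assms(1) by (simp add: digraph_def)
  show "V \<times> V - Id \<subseteq> A"
  proof (rule subrelI)
    fix u v assume "(u, v) \<in> V \<times> V - Id"
    then have uv: "u \<in> V" "v \<in> V" "u \<noteq> v" by auto
    have "card (V - {u}) \<le> card (A `` {u})"
      using lambda_k_le_outdegree[OF assms(1-3) uv(1)] assms(4) uv(1) fin by simp
    then have "A `` {u} = V - {u}"
      using card_seteq digraph_out_subset[OF assms(1)] fin by (metis finite_Diff)
    then show "(u, v) \<in> A" using uv by auto
  qed
qed

section \<open>Packings of spanning strong subgraphs in complete digraphs\<close>

text \<open>Only arc sets are recorded, because every member spans \<open>V\<close> and the host is
  always the complete digraph on \<open>V\<close>.\<close>

definition strong_family :: "'a set \<Rightarrow> nat \<Rightarrow> (nat \<Rightarrow> ('a \<times> 'a) set) \<Rightarrow> bool" where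
  "strong_family V m B \<longleftrightarrow>
     (\<forall>i<m. B i \<subseteq> V \<times> V - Id \<and> strong V (B i)) \<and>
     (\<forall>i<m. \<forall>j<m. i \<noteq> j \<longrightarrow> B i \<inter> B j = {})"

definition strong_packing :: "'a set \<Rightarrow> nat \<Rightarrow> bool" where
  "strong_packing V m \<longleftrightarrow> (\<exists>B. strong_family V m B)"

lemma strong_familyI:
  assumes "\<And>i. i < m \<Longrightarrow> B i \<subseteq> V \<times> V - Id" "\<And>i. i < m \<Longrightarrow> strong V (B i)"
    and "\<And>i j. i < m \<Longrightarrow> j < m \<Longrightarrow> i \<noteq> j \<Longrightarrow> B i \<inter> B j = {}"
  shows "strong_family V m B"
  unfolding strong_family_def using assms by simp

lemma strong_familyD:
  assumes "strong_family V m B"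
  shows "i < m \<Longrightarrow> B i \<subseteq> V \<times> V - Id" "i < m \<Longrightarrow> strong V (B i)"
    and "i < m \<Longrightarrow> j < m \<Longrightarrow> i \<noteq> j \<Longrightarrow> B i \<inter> B j = {}"
  using assms unfolding strong_family_def by simp_all

lemma strong_map_prod:
  assumes "strong V B"
  shows "strong (f ` V) (map_prod f f ` B)"
proof -
  have "(f u, f v) \<in> (map_prod f f ` B)\<^sup>*" if "(u, v) \<in> B\<^sup>*" for u v
    using that
  proof induction
    case (step y z)
    then have "(f y, f z) \<in> map_prod f f ` B" by force
    then show ?case using step.IH by (rule rtrancl_into_rtrancl[rotated])
  qed simp
  then show ?thesis using assms by (auto simp: strong_def)
qed

lemma map_prod_image_loopfree:
  assumes "B \<subseteq> V \<times> V - Id" "inj_on f V"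
  shows "map_prod f f ` B \<subseteq> f ` V \<times> f ` V - Id"
  using assms by (fastforce simp: inj_on_def)

lemma map_prod_image_disjoint:
  assumes "B \<subseteq> V \<times> V" "C \<subseteq> V \<times> V" "inj_on f V" "B \<inter> C = {}"
  shows "map_prod f f ` B \<inter> map_prod f f ` C = {}"
  using inj_on_image_Int[OF map_prod_inj_on[OF assms(3,3)] assms(1,2)] assms(4) by simp

lemma strong_family_image:
  assumes "inj_on f V" "strong_family V m B"
  shows "strong_family (f ` V) m (\<lambda>i. map_prod f f ` B i)"
proof (rule strong_familyI)
  note B = strong_familyD[OF assms(2)]
  fix i assume i: "i < m"
  show "map_prod f f ` B i \<subseteq> f ` V \<times> f ` V - Id"
    using map_prod_image_loopfree B(1)[OF i] assms(1) by metis
  show "strong (f ` V) (map_prod f f ` B i)" using strong_map_prod B(2)[OF i] by blast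
  fix j assume j: "j < m" "i \<noteq> j"
  then show "map_prod f f ` B i \<inter> map_prod f f ` B j = {}"
    using map_prod_image_disjoint[OF _ _ assms(1)] B(1)[OF i] B(1)[OF j(1)] B(3)[OF i j]
    by (metis Diff_subset subset_trans)
qed

text \<open>Only the order matters, so the explicit constructions may live on intervals of
  integers.\<close>

lemma strong_packing_card:
  assumes "strong_packing V m" "finite V" "finite W" "card W = card V"
  shows "strong_packing W m"
proof -
  obtain f where "bij_betw f V W" using finite_same_card_bij assms by metis
  then show ?thesis 
    using strong_family_image assms(1) unfolding strong_packing_def by (metis bij_betw_def)
qed

lemma packing_if_strong_packing:
  assumes "strong_packing V m" "S \<subseteq> V"
  shows "packing V (V \<times> V - Id) S m"
proof -
  obtain B where B: "strong_family V m B" using assms(1) unfolding strong_packing_def by blast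
  note D = strong_familyD(3)[OF B] and B = strong_familyD(1,2)[OF B]
  have "strong_subgraph_containing V (V \<times> V - Id) S (V, B i)" if "i < m" for i
    using B[OF that] assms(2) unfolding strong_subgraph_containing_def by auto
  then show ?thesis unfolding packing_def
    using D by (intro exI[of _ "\<lambda>i. (V, B i)"]) simp
qed

lemma strongI_hub:
  assumes "\<And>v. v \<in> V \<Longrightarrow> (c, v) \<in> A\<^sup>* \<and> (v, c) \<in> A\<^sup>*"
  shows "strong V A"
  unfolding strong_def using assms by (meson rtrancl_trans)

text \<open>The arcs at a vertex outside \<open>S\<close> form one further strong subgraph, a bidirected star.\<close>
lemma packing_star:
  assumes "strong_packing T m" "T = V - {a}" "a \<in> V" "S \<subseteq> T"
  shows "packing V (V \<times> V - Id) S (Suc m)"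
proof -
  obtain B where B: "strong_family T m B" using assms(1) unfolding strong_packing_def by blast
  note D = strong_familyD(3)[OF B] and B = strong_familyD(1,2)[OF B]
  let ?star = "{a} \<times> T \<union> T \<times> {a}"
  let ?H = "\<lambda>i. if i < m then (T, B i) else (V, ?star)"
  have star: "strong V ?star"
    using assms(2,3) by (intro strongI_hub[of _ a]) blast
  have "strong_subgraph_containing V (V \<times> V - Id) S (?H i)" for i
  proof (cases "i < m")
    case True
    then show ?thesis
      unfolding strong_subgraph_containing_def using B[of i] assms(2,4) by auto
  next
    case False
    then show ?thesis
      unfolding strong_subgraph_containing_def using star assms(2-4) by auto
  qed
  moreover have "snd (?H i) \<inter> snd (?H j) = {}" if "i < Suc m" "j < Suc m" "i \<noteq> j" for i j
  proof -
    \<comment> \<open>Every star arc meets \<open>a\<close>, and no arc of a class on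
      \<open>T\<close> does.\<close>
    have "B l \<inter> ?star = {}" if "l < m" for l using B(1)[OF that] assms(2) by blast
    then show ?thesis using D[of i j] that
      by (cases "i < m"; cases "j < m") (simp_all add: Int_commute less_Suc_eq)
  qed
  ultimately show ?thesis unfolding packing_def by (intro exI[of _ ?H]) blast
qed

section \<open>Hamiltonian decompositions of complete digraphs\<close>

lemma rtrancl_chain:
  fixes p :: "nat \<Rightarrow> 'a"
  assumes "\<And>j. k \<le> j \<Longrightarrow> j < l \<Longrightarrow> (p j, p (Suc j)) \<in> A" "k \<le> l"
  shows "(p k, p l) \<in> A\<^sup>*"
  using assms(2,1)
proof (induction l rule: dec_induct)
  case (step m)
  then show ?case by (meson less_SucI less_Suc_eq_le order.refl rtrancl.rtrancl_into_rtrancl)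
qed simp

text \<open>The vertices are the residues modulo \<open>2t\<close>, and \<open>2 * t\<close> itself stands for \<open>\<infinity>\<close>. The colour of an
  arc is the \<open>i\<close> for which it lies on the base zigzag shifted by \<open>i\<close>.\<close>
definition walecki_colour :: "int \<Rightarrow> int \<Rightarrow> int \<Rightarrow> int" where
  "walecki_colour t x y =
     (if x = 2 * t then y
      else if y = 2 * t then (x + t) mod (2 * t)
      else let d = (y - x) mod (2 * t) in
        (if odd d then x + d div 2 else x - (2 * t - d) div 2) mod (2 * t))"

text \<open>As fibres of the colour, distinct classes are disjoint by construction.\<close>

definition walecki_class :: "int \<Rightarrow> int \<Rightarrow> (int \<times> int) set" where
  "walecki_class t i = {(x, y). x \<in> {0..2 * t} \<and> y \<in> {0..2 * t} \<and> x \<noteq> y \<and> walecki_colour t x y = i}"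

text \<open>Indices below \<open>2 * t\<close> run through
  \<open>i, i + 1, i - 1, i + 2, ..., i + t\<close> modulo \<open>2 * t\<close>; the vertex at
  infinity is left out.\<close>

definition walecki_path :: "int \<Rightarrow> int \<Rightarrow> nat \<Rightarrow> int" where
  "walecki_path t i k =
     (if even k then i - int (k div 2) else i + int (k div 2) + 1) mod (2 * t)"

text \<open>Steps to an odd index go from \<open>i - j\<close> to \<open>i + j + 1\<close>, steps to
  an even index from \<open>i + j\<close> to \<open>i - j\<close>. As \<open>2 * t\<close> is even,
  the parity of the difference modulo \<open>2 * t\<close> tells the two kinds apart, and its half
  recovers \<open>j\<close> and hence \<open>i\<close>.\<close>

lemma walecki_path_arc:
  assumes "0 < t" "0 \<le> i" "i < 2 * t" "int (Suc k) < 2 * t"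
  shows "(walecki_path t i k, walecki_path t i (Suc k)) \<in> walecki_class t i"
proof (cases "even k")
  case True
  define j where "j = int (k div 2)"
  define x y where "x = (i - j) mod (2 * t)" and "y = (i + j + 1) mod (2 * t)"
  have j: "0 \<le> j" "j < t" using True assms by (auto simp: j_def elim!: evenE)
  have r: "0 \<le> x" "x < 2 * t" "0 \<le> y" "y < 2 * t" using assms(1) by (simp_all add: x_def y_def)
  have "(y - x) mod (2 * t) = (i + j + 1 - (i - j)) mod (2 * t)"
    unfolding x_def y_def by (rule mod_diff_eq)
  also have "i + j + 1 - (i - j) = 2 * j + 1" by simp
  finally have d: "(y - x) mod (2 * t) = 2 * j + 1" using j by simp
  have "(x + j) mod (2 * t) = i" unfolding x_def using assms(2,3) by (simp add: mod_simps)
  then have "walecki_colour t x y = i" using r d by (simp add: walecki_colour_def)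
  moreover have "x \<noteq> y" using d j by auto
  ultimately have "(x, y) \<in> walecki_class t i" using r by (simp add: walecki_class_def)
  then show ?thesis using True by (simp add: walecki_path_def x_def y_def j_def)
next
  case False
  define j where "j = int (k div 2) + 1"
  define x y where "x = (i + j) mod (2 * t)" and "y = (i - j) mod (2 * t)"
  have j: "1 \<le> j" "j < t" using False assms by (auto simp: j_def elim!: oddE)
  have r: "0 \<le> x" "x < 2 * t" "0 \<le> y" "y < 2 * t" using assms(1) by (simp_all add: x_def y_def)
  have "(y - x) mod (2 * t) = (i - j - (i + j)) mod (2 * t)"
    unfolding x_def y_def by (rule mod_diff_eq)
  \<comment> \<open>Adding \<open>2 * t\<close> moves the negative difference \<open>- 2 * j\<close>
    into the range of residues.\<close>
  also have "\<dots> = (i - j - (i + j) + 2 * t) mod (2 * t)" by (rule mod_add_self2[symmetric])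
  also have "i - j - (i + j) + 2 * t = 2 * (t - j)" by simp
  also have "2 * (t - j) mod (2 * t) = 2 * (t - j)" using j by (intro mod_pos_pos_trivial) auto
  finally have d: "(y - x) mod (2 * t) = 2 * (t - j)" .
  have "(x - j) mod (2 * t) = i" unfolding x_def using assms(2,3) by (simp add: mod_simps)
  then have "walecki_colour t x y = i" using r d by (simp add: walecki_colour_def)
  moreover have "x \<noteq> y" using d j by auto
  ultimately have "(x, y) \<in> walecki_class t i" using r by (simp add: walecki_class_def)
  then show ?thesis using False by (simp add: walecki_path_def x_def y_def j_def algebra_simps)
qed

text \<open>Half of the residues have the form \<open>i - j\<close> with \<open>j < t\<close> and
  sit at even indices. The others have the form \<open>i + j + 1\<close> and sit at odd ones; there
  \<open>j\<close> is \<open>2 * t - 1 - d\<close>, where \<open>d\<close> is the residue of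
  \<open>i - x\<close>.\<close>

lemma walecki_path_surj:
  assumes "0 < t" "0 \<le> x" "x < 2 * t"
  obtains k where "int k < 2 * t" "walecki_path t i k = x"
proof (cases "(i - x) mod (2 * t) < t")
  case True
  define j where "j = (i - x) mod (2 * t)"
  have j: "0 \<le> j" "j < t" using True assms(1) by (simp_all add: j_def)
  have "(i - j) mod (2 * t) = x" unfolding j_def using assms by (simp add: mod_simps)
  then have "walecki_path t i (nat (2 * j)) = x"
    using j by (simp add: walecki_path_def even_nat_iff nat_mult_distrib)
  then show thesis using that[of "nat (2 * j)"] j by simp
next
  case False
  define d where "d = (i - x) mod (2 * t)"
  define j where "j = 2 * t - 1 - d"
  have j: "0 \<le> j" "j < t"
    using False assms(1) pos_mod_bound[of "2 * t" "i - x"] by (auto simp: j_def d_def)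
  have "i + j + 1 = i - d + 2 * t" by (simp add: j_def)
  then have "(i + j + 1) mod (2 * t) = (i - d) mod (2 * t)" by (metis mod_add_self2)
  also have "\<dots> = x" unfolding d_def using assms by (simp add: mod_simps)
  finally have "walecki_path t i (Suc (2 * nat j)) = x"
    using j by (simp add: walecki_path_def)
  then show thesis using that[of "Suc (2 * nat j)"] j by simp
qed

text \<open>Infinity, encoded as \<open>2 * t\<close>, closes the zigzag to a Hamiltonian cycle
  inside the class: it has an arc to \<open>i\<close> and one from \<open>i + t\<close>.\<close>

lemma walecki_class_strong:
  assumes "0 < t" "0 \<le> i" "i < 2 * t"
  shows "strong {0..2 * t} (walecki_class t i)"
proof (rule strongI_hub[of _ "2 * t"])
  fix v assume v: "v \<in> {0..2 * t}"
  let ?R = "walecki_class t i" and ?p = "walecki_path t i"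
  \<comment> \<open>The last index of the zigzag, whose \<open>2 * t\<close> vertices are counted
    from 0.\<close>
  let ?l = "nat (2 * t) - 1"
  have first: "(2 * t, ?p 0) \<in> ?R"
    using assms by (simp add: walecki_class_def walecki_path_def walecki_colour_def)
  have last: "(?p ?l, 2 * t) \<in> ?R"
  proof -
    have l: "?l = Suc (2 * nat (t - 1))" using assms(1) by simp
    have p: "?p ?l = (i + t) mod (2 * t)" unfolding l using assms by (simp add: walecki_path_def)
    have "((i + t) mod (2 * t) + t) mod (2 * t) = i"
      using assms by (simp add: mod_simps add.assoc flip: mult_2)
    moreover have "(i + t) mod (2 * t) < 2 * t" "0 \<le> (i + t) mod (2 * t)" using assms by simp_all
    ultimately show ?thesis unfolding p by (simp add: walecki_class_def walecki_colour_def)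
  qed
  have chain: "(?p k, ?p l) \<in> ?R\<^sup>*" if "k \<le> l" "l \<le> ?l" for k l
    using that by (intro rtrancl_chain walecki_path_arc assms) auto
  show "(2 * t, v) \<in> ?R\<^sup>* \<and> (v, 2 * t) \<in> ?R\<^sup>*"
  proof (cases "v = 2 * t")
    case False
    then obtain k where k: "int k < 2 * t" "?p k = v"
      using walecki_path_surj[OF assms(1), of v i] v by auto
    then have "k \<le> ?l" by simp
    then show ?thesis using chain[of 0 k] chain[of k ?l] first last k(2)
      by (auto intro: converse_rtrancl_into_rtrancl rtrancl_into_rtrancl)
  qed simp
qed

lemma walecki_family:
  assumes "0 < t"
  shows "strong_family {0..2 * t} (nat (2 * t)) (\<lambda>i. walecki_class t (int i))"
proof (rule strong_familyI)
  show "walecki_class t (int i) \<subseteq> {0..2 * t} \<times> {0..2 * t} - Id" for i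
    by (auto simp: walecki_class_def)
  show "strong {0..2 * t} (walecki_class t (int i))" if "i < nat (2 * t)" for i
    using walecki_class_strong[OF assms] that by simp
  show "walecki_class t (int i) \<inter> walecki_class t (int j) = {}" if "i \<noteq> j" for i j
    using that by (auto simp: walecki_class_def)
qed

section \<open>Even order: extension by one vertex\<close>

text \<open>Walks through the deleted arc take the detour via \<open>a\<close>, which is entered
  from \<open>x\<close> and left to \<open>y\<close>.\<close>

lemma strong_subdivide:
  assumes "strong V B" "(x, y) \<in> B" "x \<in> V" "y \<in> V"
  shows "strong (insert a V) (B - {(x, y)} \<union> {(x, a), (a, y)})" (is "strong _ ?C")
proof -
  have xay: "(x, a) \<in> ?C\<^sup>*" "(a, y) \<in> ?C\<^sup>*" by auto
  have "B \<subseteq> ?C\<^sup>*"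
  proof (rule subrelI)
    fix u v assume "(u, v) \<in> B"
    then show "(u, v) \<in> ?C\<^sup>*"
      using xay by (cases "(u, v) = (x, y)") (auto intro: rtrancl_trans)
  qed
  then have "B\<^sup>* \<subseteq> ?C\<^sup>*" using rtrancl_subset_rtrancl by blast
  then have V: "(u, v) \<in> ?C\<^sup>*" if "u \<in> V" "v \<in> V" for u v
    using assms(1) that unfolding strong_def by blast
  show ?thesis
  proof (rule strongI_hub[of _ a])
    fix v assume "v \<in> insert a V"
    then show "(a, v) \<in> ?C\<^sup>* \<and> (v, a) \<in> ?C\<^sup>*"
      using V[of y v] V[of v x] xay assms(3,4) by (auto intro: rtrancl_trans)
  qed
qed

text \<open>A rainbow path through all vertices, closed up through a new vertex, becomes an additional
  subgraph once each of its arcs has been rerouted through the new vertex in its own class.\<close>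
lemma strong_packing_insert:
  assumes fam: "strong_family V m B"
    and e: "\<And>i. i < m \<Longrightarrow> (x i, y i) \<in> B i" "inj_on x {..<m}" "inj_on y {..<m}"
    and a: "a \<notin> V" and uv: "u \<in> V" "u \<notin> x ` {..<m}" "v \<in> V" "v \<notin> y ` {..<m}"
    and str: "strong (insert a V) ((\<lambda>i. (x i, y i)) ` {..<m} \<union> {(u, a), (a, v)})"
  shows "strong_packing (insert a V) (Suc m)"
proof -
  note B = strong_familyD[OF fam]
  let ?B = "\<lambda>i. B i - {(x i, y i)} \<union> {(x i, a), (a, y i)}"
  let ?P = "(\<lambda>i. (x i, y i)) ` {..<m} \<union> {(u, a), (a, v)}"
  let ?C = "\<lambda>i. if i < m then ?B i else ?P"
  have xy: "x i \<in> V" "y i \<in> V" "x i \<noteq> y i" if "i < m" for i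
    using B(1)[OF that] e(1)[OF that] by auto
  have C: "?C i \<subseteq> insert a V \<times> insert a V - Id \<and> strong (insert a V) (?C i)" for i
  proof (cases "i < m")
    case True
    then show ?thesis using strong_subdivide B(1,2)[OF True] e(1)[OF True] xy[OF True] a
      by auto
  next
    case False
    then show ?thesis using str xy a uv by auto
  qed
  \<comment> \<open>The new arcs at \<open>a\<close> differ because tails and heads are injective in
    the class index.\<close>
  have BB: "?B i \<inter> ?B j = {}" if "i < m" "j < m" "i \<noteq> j" for i j
  proof -
    have "x i \<noteq> x j" "y i \<noteq> y j" using e(2,3) that by (auto simp: inj_on_def)
    moreover have "(w, a) \<notin> B l" "(a, w) \<notin> B l" if "l < m" for w l
      using B(1)[OF that] a by auto
    moreover have "x i \<noteq> a" "y i \<noteq> a" "x j \<noteq> a" "y j \<noteq> a" using xy a that by auto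
    ultimately show ?thesis using B(3)[OF that] that(1,2) by auto
  qed
  \<comment> \<open>The arc \<open>(x j, y j)\<close> was removed from its own class and lies in no
    other; the closing arcs are new because \<open>u\<close> is no tail and \<open>v\<close> no head
    of a removed arc.\<close>
  have BP: "?B i \<inter> ?P = {}" if "i < m" for i
  proof -
    define C where "C = ?B i"
    have "(x j, y j) \<notin> C" if "j < m" for j unfolding C_def
      using B(3)[of i j] e(1)[OF that] \<open>i < m\<close> that a xy[of j] by (cases "i = j") auto
    moreover have "(u, a) \<notin> C" "(a, v) \<notin> C"
      unfolding C_def using B(1)[OF that] a uv xy[OF that] that by auto
    ultimately have "C \<inter> ?P = {}" by blast
    then show ?thesis by (simp only: C_def)
  qed
  have disj: "?C i \<inter> ?C j = {}" if ij: "i < Suc m" "j < Suc m" "i \<noteq> j" for i j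
  proof -
    consider "i < m" "j < m" | "i < m" "\<not> j < m" | "\<not> i < m" "j < m"
      using ij less_antisym by metis
    then show ?thesis
    proof cases
      case 1
      then show ?thesis using BB[OF 1 ij(3)] by (simp only: if_True)
    next
      case 2
      then show ?thesis using BP[of i] by (simp only: if_True if_False)
    next
      case 3
      then show ?thesis using BP[of j] by (simp only: if_True if_False Int_commute)
    qed
  qed
  have "strong_family (insert a V) (Suc m) ?C"
    by (rule strong_familyI) (rule C[THEN conjunct1] C[THEN conjunct2] disj; assumption)+
  then show ?thesis unfolding strong_packing_def by blast
qed

text \<open>The Hamiltonian path is indexed by colour: its arc of colour \<open>c\<close> goes from \<open>rainbow_tail t c\<close> to
  \<open>rainbow_head t c\<close>.\<close>
definition rainbow_tail :: "int \<Rightarrow> int \<Rightarrow> int" where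
  "rainbow_tail t c = (if c = 0 then 2 else if c = 2 * t - 1 then t else if c = t then 1
     else if c = t - 1 then 0 else if c = 1 then t + 1 else c + 1)"

definition rainbow_head :: "int \<Rightarrow> int \<Rightarrow> int" where
  "rainbow_head t c = (if c = 0 then 2 * t - 2 else if c = 2 * t - 1 then t - 1 else if c = t then 0
     else if c = t - 1 then 2 * t - 1 else if c = 1 then 2 * t else c - 1)"

text \<open>A regular arc from \<open>x\<close> to \<open>x - 2\<close> has colour
  \<open>x - 1\<close>. Regular arcs at the exceptional tails \<open>0, 1, 2, t, t + 1\<close> would
  have colours \<open>2 * t - 1, 0, 1, t - 1, t\<close>; the exceptional arcs carry these same five
  colours, permuted.\<close>

lemma rainbow_arc:
  assumes "3 \<le> t" "0 \<le> c" "c < 2 * t"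
  shows "(rainbow_tail t c, rainbow_head t c) \<in> walecki_class t c"
proof -
  let ?x = "rainbow_tail t c" and ?y = "rainbow_head t c"
  have mod: "z mod (2 * t) = z" if "0 \<le> z" "z < 2 * t" for z using that by simp
  have neg: "(- z) mod (2 * t) = 2 * t - z" if "0 < z" "z \<le> 2 * t" for z
  proof -
    have "(- z) mod (2 * t) = (- z + 2 * t) mod (2 * t)" by (rule mod_add_self2[symmetric])
    also have "\<dots> = - z + 2 * t" by (rule mod) (use that in auto)
    finally show ?thesis by simp
  qed
  have "walecki_colour t ?x ?y = c"
  proof -
    consider "c = 0" | "c = 2 * t - 1" | "c = t" | "c = t - 1" | "c = 1"
      | "1 < c" "c < 2 * t - 1" "c \<noteq> t" "c \<noteq> t - 1" using assms by linarith
    then show ?thesis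
    proof cases
      case 1
      have "(2 * t - 4) mod (2 * t) = 2 * t - 4" using assms by (intro mod) auto
      then show ?thesis
        using assms 1 by (simp add: walecki_colour_def rainbow_tail_def rainbow_head_def)
    next
      case 2
      have "2 * t - 1 = 2 * (t - 1) + 1" by simp
      then have "odd (2 * t - 1)" "(2 * t - 1) div 2 = t - 1" by presburger+
      then show ?thesis
        using assms 2 neg[of 1] by (simp add: walecki_colour_def rainbow_tail_def rainbow_head_def Let_def)
    next
      case 3
      have "odd (2 * t - 1)" "(2 * t - 1) div 2 = t - 1" by presburger+
      then show ?thesis
        using assms 3 neg[of 1] by (simp add: walecki_colour_def rainbow_tail_def rainbow_head_def Let_def)
    next
      case 4
      have "odd (2 * t - 1)" "(2 * t - 1) div 2 = t - 1" by presburger+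
      then show ?thesis
        using assms 4 neg[of 1] by (simp add: walecki_colour_def rainbow_tail_def rainbow_head_def Let_def)
    next
      case 5
      have "(t + 1 + t) mod (2 * t) = (1 + 2 * t) mod (2 * t)" by (simp add: algebra_simps)
      also have "\<dots> = 1 mod (2 * t)" by (rule mod_add_self2)
      finally have "(t + 1 + t) mod (2 * t) = 1" using assms by simp
      then show ?thesis
        using assms 5 by (simp add: walecki_colour_def rainbow_tail_def rainbow_head_def)
    next
      case 6
      have "(c - 1 - (c + 1)) mod (2 * t) = 2 * t - 2" using neg[of 2] assms by simp
      then show ?thesis
        using assms 6 by (simp add: walecki_colour_def rainbow_tail_def rainbow_head_def)
    qed
  qed
  moreover have "?x \<in> {0..2 * t}" "?y \<in> {0..2 * t}" "?x \<noteq> ?y"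
    using assms by (auto simp: rainbow_tail_def rainbow_head_def)
  ultimately show ?thesis by (simp add: walecki_class_def)
qed

lemma rainbow_cycle_strong:
  assumes "3 \<le> t"
  shows "strong (insert (2 * t + 1) {0..2 * t})
    ((\<lambda>i. (rainbow_tail t (int i), rainbow_head t (int i))) ` {..<nat (2 * t)}
      \<union> {(2 * t, 2 * t + 1), (2 * t + 1, t - 2)})" (is "strong ?W ?P")
proof -
  define R where "R = ?P"
  have arc: "(x, y) \<in> R" if "0 \<le> c" "c < 2 * t" "x = rainbow_tail t c" "y = rainbow_head t c" for x y c
    unfolding R_def using that by (auto intro!: image_eqI[of _ _ "nat c"])
  have j: "(2, 2 * t - 2) \<in> R" "(t, t - 1) \<in> R" "(1, 0) \<in> R" "(0, 2 * t - 1) \<in> R" "(t + 1, 2 * t) \<in> R"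
    using assms arc[of 0] arc[of "2 * t - 1"] arc[of t] arc[of "t - 1"] arc[of 1]
    by (simp_all add: rainbow_tail_def rainbow_head_def)
  have inf: "(2 * t, 2 * t + 1) \<in> R" "(2 * t + 1, t - 2) \<in> R" by (auto simp: R_def)
  have step: "(z, z - 2) \<in> R" if "3 \<le> z" "z < 2 * t" "z \<noteq> t" "z \<noteq> t + 1" for z
    using that arc[of "z - 1"] by (simp add: rainbow_tail_def rainbow_head_def)
  \<comment> \<open>Within \<open>1, ..., t - 1\<close> and within \<open>t, ..., 2 * t - 1\<close>
    the exceptional tails are the two smallest elements, so a descent by steps of 2 stays regular
    until it ends.\<close>
  have desc: "(x, z) \<in> R\<^sup>*"
    if "z \<le> x" "even (x - z)" "1 \<le> z \<and> x < t \<or> t \<le> z \<and> x < 2 * t" for x z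
  proof -
    define k where "k = nat ((x - z) div 2)"
    have k: "z = x - 2 * int k" using that(1,2) by (auto simp: k_def)
    have "(x - 2 * int 0, x - 2 * int k) \<in> R\<^sup>*"
    proof (rule rtrancl_chain)
      fix j assume "j < k"
      then have "3 \<le> x - 2 * int j" "x - 2 * int j < 2 * t" "x - 2 * int j \<noteq> t" "x - 2 * int j \<noteq> t + 1"
        using that(3) k by auto
      from step[OF this] show "(x - 2 * int j, x - 2 * int (Suc j)) \<in> R" by (simp add: algebra_simps)
    qed simp
    then show ?thesis using k by simp
  qed
  let ?a = "2 * t + 1"
  note arcs = r_into_rtrancl[OF j(1)] r_into_rtrancl[OF j(2)] r_into_rtrancl[OF j(3)]
    r_into_rtrancl[OF j(4)] r_into_rtrancl[OF j(5)] r_into_rtrancl[OF inf(1)] r_into_rtrancl[OF inf(2)]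
  have zero: "(1, 2 * t - 1) \<in> R\<^sup>*" by (rule rtrancl_trans[OF arcs(3,4)])
  have from_top: "(t + 1, ?a) \<in> R\<^sup>*" by (rule rtrancl_trans[OF arcs(5,6)])
  \<comment> \<open>The parity of \<open>t\<close> decides the order in which the descending runs
    are traversed; recorded here is how their ends connect with the hub \<open>?a\<close>.\<close>
  have reach: "(?a, t - 2) \<in> R\<^sup>* \<and> (?a, t - 1) \<in> R\<^sup>* \<and> (?a, 2 * t - 2) \<in> R\<^sup>* \<and>
    (?a, 2 * t - 1) \<in> R\<^sup>* \<and> (?a, 1) \<in> R\<^sup>* \<and>
    (1, ?a) \<in> R\<^sup>* \<and> (2, ?a) \<in> R\<^sup>* \<and> (t, ?a) \<in> R\<^sup>* \<and> (2 * t - 1, ?a) \<in> R\<^sup>*"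
  proof (cases "even t")
    case True
    \<comment> \<open>The path is \<open>t - 2\<close> down to \<open>2\<close>,
      \<open>2 * t - 2\<close> down to \<open>t\<close>, \<open>t - 1\<close> down to
      \<open>1\<close>, then \<open>0\<close>, \<open>2 * t - 1\<close> down to
      \<open>t + 1\<close>, and infinity.\<close>
    then have "4 \<le> t" using assms by presburger
    then have d: "(t - 2, 2) \<in> R\<^sup>*" "(2 * t - 2, t) \<in> R\<^sup>*" "(t - 1, 1) \<in> R\<^sup>*"
        "(2 * t - 1, t + 1) \<in> R\<^sup>*"
      using True by (auto intro!: desc)
    have "(?a, 2 * t - 2) \<in> R\<^sup>*"
      by (rule rtrancl_trans[OF arcs(7) rtrancl_trans[OF d(1) arcs(1)]])
    moreover have "(2 * t - 2, t - 1) \<in> R\<^sup>*" by (rule rtrancl_trans[OF d(2) arcs(2)])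
    moreover have "(1, ?a) \<in> R\<^sup>*"
      by (rule rtrancl_trans[OF zero rtrancl_trans[OF d(4) from_top]])
    ultimately show ?thesis using d arcs zero from_top by (meson rtrancl_trans)
  next
    case False
    \<comment> \<open>The path is \<open>t - 2\<close> down to \<open>1\<close>, then
      \<open>0\<close>, \<open>2 * t - 1\<close> down to \<open>t\<close>, \<open>t - 1\<close> down
      to \<open>2\<close>, \<open>2 * t - 2\<close> down to \<open>t + 1\<close>, and
      infinity.\<close>
    then have d: "(t - 2, 1) \<in> R\<^sup>*" "(2 * t - 1, t) \<in> R\<^sup>*" "(t - 1, 2) \<in> R\<^sup>*"
        "(2 * t - 2, t + 1) \<in> R\<^sup>*"
      using assms by (auto intro!: desc)
    have "(?a, 2 * t - 1) \<in> R\<^sup>*"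
      by (rule rtrancl_trans[OF arcs(7) rtrancl_trans[OF d(1) zero]])
    moreover have "(2 * t - 1, t - 1) \<in> R\<^sup>*" by (rule rtrancl_trans[OF d(2) arcs(2)])
    moreover have "(2, ?a) \<in> R\<^sup>*"
      by (rule rtrancl_trans[OF arcs(1) rtrancl_trans[OF d(4) from_top]])
    ultimately show ?thesis using d arcs zero from_top by (meson rtrancl_trans)
  qed
  have "strong ?W R"
  proof (rule strongI_hub[of _ ?a])
    fix v assume "v \<in> ?W"
    then consider "v = ?a" | "v = 2 * t" | "v = 0" | "1 \<le> v" "v < t" | "t \<le> v" "v < 2 * t"
      by fastforce
    then show "(?a, v) \<in> R\<^sup>* \<and> (v, ?a) \<in> R\<^sup>*"
    proof cases
      case 2
      have "(2 * t - 1, t + 1) \<in> R\<^sup>* \<or> (2 * t - 2, t + 1) \<in> R\<^sup>*"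
        using assms by (cases "even t") (auto intro!: desc)
      then have "(?a, t + 1) \<in> R\<^sup>*" using reach rtrancl_trans by metis
      then show ?thesis using 2 arcs(5,6) rtrancl_trans by metis
    next
      case 3
      then show ?thesis using reach arcs(3,4) rtrancl_trans by metis
    next
      case 4
      have "(t - 2, v) \<in> R\<^sup>* \<or> (t - 1, v) \<in> R\<^sup>*"
      proof (cases "even (t - v)")
        case True
        then have "v \<noteq> t - 1" by auto
        then show ?thesis using 4 True by (intro disjI1[OF desc]) auto
      next
        case False
        then have "even (t - 1 - v)" by presburger
        then show ?thesis using 4 by (intro disjI2[OF desc]) auto
      qed
      moreover have "(v, 1) \<in> R\<^sup>* \<or> (v, 2) \<in> R\<^sup>*"
      proof (cases "even v")
        case True
        then have "v \<noteq> 1" by auto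
        then show ?thesis using 4 True by (intro disjI2[OF desc]) auto
      next
        case False
        then show ?thesis using 4 False by (intro disjI1[OF desc]) auto
      qed
      ultimately show ?thesis using reach rtrancl_trans by metis
    next
      case 5
      have "(2 * t - 2, v) \<in> R\<^sup>* \<or> (2 * t - 1, v) \<in> R\<^sup>*"
      proof (cases "even v")
        case True
        then have "v \<noteq> 2 * t - 1" by auto
        then show ?thesis using 5 True by (intro disjI1[OF desc]) auto
      next
        case False
        then have "even (2 * t - 1 - v)" by presburger
        then show ?thesis using 5 by (intro disjI2[OF desc]) auto
      qed
      moreover have "(v, t) \<in> R\<^sup>* \<or> (v, t + 1) \<in> R\<^sup>*"
      proof (cases "even (v - t)")
        case True
        then show ?thesis using 5 by (intro disjI1[OF desc]) auto
      next
        case False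
        then have "v \<noteq> t" by auto
        then show ?thesis using 5 False by (intro disjI2[OF desc]) auto
      qed
      ultimately show ?thesis using reach from_top rtrancl_trans by metis
    qed simp
  qed
  then show ?thesis by (simp only: R_def)
qed

lemma strong_packing_even:
  assumes "3 \<le> t"
  shows "strong_packing {0..2 * t + 1} (Suc (nat (2 * t)))"
proof -
  have "strong_packing (insert (2 * t + 1) {0..2 * t}) (Suc (nat (2 * t)))"
  proof (rule strong_packing_insert[where B = "\<lambda>i. walecki_class t (int i)"
        and x = "\<lambda>i. rainbow_tail t (int i)" and y = "\<lambda>i. rainbow_head t (int i)"])
    show "strong_family {0..2 * t} (nat (2 * t)) (\<lambda>i. walecki_class t (int i))"
      using walecki_family assms by simp
    show "inj_on (\<lambda>i. rainbow_tail t (int i)) {..<nat (2 * t)}"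
      using assms by (auto simp: inj_on_def rainbow_tail_def split: if_splits)
    show "inj_on (\<lambda>i. rainbow_head t (int i)) {..<nat (2 * t)}"
      using assms by (auto simp: inj_on_def rainbow_head_def split: if_splits)
    \<comment> \<open>Infinity is the last vertex of the path and \<open>t - 2\<close> its
      first.\<close>
    show "2 * t \<notin> (\<lambda>i. rainbow_tail t (int i)) ` {..<nat (2 * t)}"
      using assms by (auto simp: rainbow_tail_def split: if_splits)
    show "t - 2 \<notin> (\<lambda>i. rainbow_head t (int i)) ` {..<nat (2 * t)}"
      using assms by (auto simp: rainbow_head_def split: if_splits)
  qed (use assms rainbow_arc rainbow_cycle_strong in auto)
  moreover have "insert (2 * t + 1) {0..2 * t} = {0..2 * t + 1}" using assms by auto
  ultimately show ?thesis by simp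
qed

section \<open>Orders four and six\<close>

text \<open>Pigeonhole: each of the \<open>m\<close> classes needs an arc out of \<open>v\<close>,
  and only \<open>m\<close> such arcs exist, so each class has exactly one.\<close>

lemma full_strong_packing_heads:
  assumes fam: "strong_family V m B"
    and V: "finite V" "card V = Suc m" "2 \<le> card V" "v \<in> V"
  obtains h where "h ` {..<m} = V - {v}" "\<And>i y. i < m \<Longrightarrow> (v, y) \<in> B i \<longleftrightarrow> y = h i"
proof -
  note B = strong_familyD(1,2)[OF fam] and D = strong_familyD(3)[OF fam]
  obtain w where w: "w \<in> V" "w \<noteq> v" using other_element V(3,4) by metis
  have "\<exists>y. (v, y) \<in> B i" if "i < m" for i
    using strong_out_arc[OF B(2)[OF that] V(4) w(1)] w(2) by metis
  then obtain h where h: "\<And>i. i < m \<Longrightarrow> (v, h i) \<in> B i" by metis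
  have "inj_on h {..<m}" by (rule inj_onI) (use h D in fastforce)
  then have "card (h ` {..<m}) = card (V - {v})" using V by (simp add: card_image)
  moreover have "h ` {..<m} \<subseteq> V - {v}" using h B(1) by fastforce
  ultimately have im: "h ` {..<m} = V - {v}" using V(1) by (intro card_subset_eq) auto
  have "y = h i" if i: "i < m" and y: "(v, y) \<in> B i" for i y
  proof -
    have "y \<in> V - {v}" using B(1)[OF i] y by auto
    then obtain j where j: "j < m" "y = h j" unfolding im[symmetric] by blast
    then have "(v, y) \<in> B i \<inter> B j" using h y by simp
    then show ?thesis using D[OF i j(1)] j by auto
  qed
  then show thesis using that[OF im] h by blast
qed

lemma full_strong_packing_single_valued:
  assumes fam: "strong_family V m B"
    and V: "finite V" "card V = Suc m" "2 \<le> card V" and i: "i < m"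
  shows "single_valued (B i)"
proof (rule single_valuedI)
  fix v y z assume yz: "(v, y) \<in> B i" "(v, z) \<in> B i"
  then have "v \<in> V" using strong_familyD(1)[OF fam i] by auto
  then obtain h where "\<And>y. (v, y) \<in> B i \<longleftrightarrow> y = h i"
    using full_strong_packing_heads[OF fam V] i by metis
  then show "y = z" using yz by simp
qed

text \<open>With unique successors, strength means that the orbit of \<open>v\<close> covers
  \<open>V\<close>. The orbit is periodic from its first return to \<open>v\<close> and injective
  before it, so this return happens after \<open>card V\<close> steps.\<close>

lemma strong_functional_cycle:
  assumes B: "strong V B" "single_valued B" and BV: "B \<subseteq> V \<times> V" and V: "finite V" "2 \<le> card V" "v \<in> V"
  obtains f where "bij_betw f {..<card V} V" "f 0 = v"
    "\<And>i. i < card V \<Longrightarrow> (f i, f (Suc i mod card V)) \<in> B"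
proof -
  have "\<exists>y. (x, y) \<in> B" if "x \<in> V" for x
    using other_element[OF V(2) that] strong_out_arc[OF B(1) that] by metis
  then obtain g where g: "\<And>x. x \<in> V \<Longrightarrow> (x, g x) \<in> B" by metis
  define f where "f i = (g ^^ i) v" for i
  have f0: "f 0 = v" by (simp add: f_def)
  have B_eq: "y = g x" if "(x, y) \<in> B" "x \<in> V" for x y
    using B(2) that g by (auto dest: single_valuedD)
  have reach: "(f k, w) \<in> B\<^sup>* \<Longrightarrow> f k \<in> V \<Longrightarrow> \<exists>i\<ge>k. w = f i \<and> f i \<in> V" for k w
  proof (induction rule: rtrancl_induct)
    case (step y z)
    then obtain i where i: "i \<ge> k" "y = f i" "f i \<in> V" by blast
    then have z: "z = f (Suc i)" using step.hyps(2) B_eq by (simp add: f_def)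
    then show ?case using i step.hyps(2) BV by (intro exI[of _ "Suc i"]) auto
  qed auto
  have v: "f 0 \<in> V" using V(3) f0 by simp
  have fV: "f i \<in> V" for i
  proof (induction i)
    case (Suc i)
    then show ?case using g[of "f i"] BV by (auto simp: f_def)
  qed (rule v)
  have arc: "(f i, f (Suc i)) \<in> B" for i using g[OF fV[of i]] by (simp add: f_def)
  \<comment> \<open>Strength applied from \<open>f k\<close> shows that every vertex recurs beyond
    any index; hence \<open>v\<close> returns at a positive one.\<close>
  have all: "\<exists>i\<ge>k. w = f i" if "w \<in> V" for k w
    using reach[of k w] fV[of k] B(1) that unfolding strong_def by blast
  define p where "p = (LEAST p. 1 \<le> p \<and> f p = v)"
  obtain q where "1 \<le> q" "v = f q" using all[OF V(3), of 1] by blast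
  then have "1 \<le> q \<and> f q = v" by metis
  then have p: "1 \<le> p \<and> f p = v" unfolding p_def by (rule LeastI)
  have min: "f q \<noteq> v" if "1 \<le> q" "q < p" for q
    using not_less_Least[of q "\<lambda>p. 1 \<le> p \<and> f p = v"] that unfolding p_def by blast
  have mod: "f (i mod p) = f i" for i
    unfolding f_def by (rule funpow_mod_eq) (use p in \<open>simp add: f_def\<close>)
  have inj: "inj_on f {..<p}"
  proof (rule linorder_inj_onI)
    fix i j assume ij: "i < j" "i \<in> {..<p}" "j \<in> {..<p}"
    show "f i \<noteq> f j"
    proof
      assume "f i = f j"
      \<comment> \<open>Advancing both sides by \<open>p - j\<close> steps turns a repetition into a
        return to \<open>v\<close> earlier than \<open>p\<close>.\<close>
      then have "(g ^^ (p - j)) (f i) = (g ^^ (p - j)) (f j)" by simp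
      then have "f (p - j + i) = f p" using ij by (simp add: f_def flip: funpow_add comp_apply[of "g ^^ _"])
      moreover have "1 \<le> p - j + i" "p - j + i < p" using ij by auto
      ultimately show False using min p by metis
    qed
  qed auto
  have "f ` {..<p} = V"
  proof
    show "V \<subseteq> f ` {..<p}"
    proof
      fix w assume "w \<in> V"
      then obtain i where "w = f i" using all by blast
      then have "w = f (i mod p)" by (simp add: mod)
      then show "w \<in> f ` {..<p}" using p by simp
    qed
  qed (use fV in blast)
  then have bij: "bij_betw f {..<p} V" using inj by (simp add: bij_betw_def)
  then have "p = card V" using bij_betw_same_card by fastforce
  then show thesis using that[of f] bij f0 arc mod by metis
qed

section \<open>Finite search over Hamiltonian cycles\<close>

definition cycle_arcs :: "nat list \<Rightarrow> (nat \<times> nat) list" where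
  "cycle_arcs xs = zip xs (rotate1 xs)"

definition arcs_disjoint :: "nat list \<Rightarrow> nat list \<Rightarrow> bool" where
  "arcs_disjoint xs ys \<longleftrightarrow> (\<forall>e\<in>set (cycle_arcs xs). e \<notin> set (cycle_arcs ys))"

text \<open>Executable list of candidates for the cycle leaving \<open>0\<close> towards
  \<open>y\<close>, already filtered against the normalised cycle.\<close>

definition six_cycles :: "nat \<Rightarrow> nat list list" where
  "six_cycles y = filter (arcs_disjoint [0..<6])
    [[0, y, a, b, c, d].
      a \<leftarrow> filter (\<lambda>a. a \<noteq> y) [1..<6],
      b \<leftarrow> filter (\<lambda>b. b \<notin> {y, a}) [1..<6],
      c \<leftarrow> filter (\<lambda>c. c \<notin> {y, a, b}) [1..<6],
      d \<leftarrow> filter (\<lambda>d. d \<notin> {y, a, b, c}) [1..<6]]"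

text \<open>The normalised cycle uses the arc from \<open>0\<close> to \<open>1\<close>; the other
  four cycles of a decomposition would leave \<open>0\<close> towards \<open>2, 3, 4, 5\<close>.
  Evaluation of all combinations excludes this.\<close>

lemma six_cycles_clash:
  assumes "p \<in> set (six_cycles 2)" "q \<in> set (six_cycles 3)"
    and "r \<in> set (six_cycles 4)" "s \<in> set (six_cycles 5)"
    and "arcs_disjoint p q" "arcs_disjoint p r" "arcs_disjoint p s"
    and "arcs_disjoint q r" "arcs_disjoint q s" "arcs_disjoint r s"
  shows False
proof -
  \<comment> \<open>Conditionals instead of implications let the simplifier prune the search.\<close>
  have "\<forall>p\<in>set (six_cycles 2). \<forall>q\<in>set (six_cycles 3). if arcs_disjoint p q then
      \<forall>r\<in>set (six_cycles 4). if arcs_disjoint p r then if arcs_disjoint q r then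
        \<forall>s\<in>set (six_cycles 5). if arcs_disjoint p s then if arcs_disjoint q s then
          \<not> arcs_disjoint r s
      else True else True else True else True else True"
    by code_simp
  from this[THEN bspec, OF assms(1), THEN bspec, OF assms(2), unfolded if_P[OF assms(5)],
      THEN bspec, OF assms(3), unfolded if_P[OF assms(6)] if_P[OF assms(8)],
      THEN bspec, OF assms(4), unfolded if_P[OF assms(7)] if_P[OF assms(9)]]
  show False using assms(10) by (rule notE)
qed

lemma cycle_arcs_map:
  assumes "0 < n"
  shows "set (cycle_arcs (map f [0..<n])) = (\<lambda>i. (f i, f (Suc i mod n))) ` {..<n}"
proof -
  have "rotate1 (map f [0..<n]) = map (\<lambda>i. f (Suc i mod n)) [0..<n]"
    by (rule nth_equalityI) (simp_all add: nth_rotate1)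
  then show ?thesis by (auto simp: cycle_arcs_def zip_map_map zip_same_conv_map lessThan_atLeast0)
qed

text \<open>Relabelling the vertices along one of the cycles makes that cycle \<open>0, 1, \<dots>, n - 1\<close>.\<close>
lemma full_strong_packing_cycles:
  assumes "strong_packing V m" "finite V" "card V = Suc m" "1 \<le> m"
  obtains f where "\<And>y. y \<in> {1..m} \<Longrightarrow> bij_betw (f y) {..m} {..m} \<and> f y 0 = 0 \<and> f y 1 = y"
    "\<And>y z. y \<in> {1..m} \<Longrightarrow> z \<in> {1..m} \<Longrightarrow> y \<noteq> z \<Longrightarrow>
      arcs_disjoint (map (f y) [0..<Suc m]) (map (f z) [0..<Suc m])"
    "f 1 = id"
proof -
  obtain B where fam: "strong_family V m B" using assms(1) unfolding strong_packing_def by blast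
  note B = strong_familyD(1,2)[OF fam]
  have V2: "2 \<le> card V" using assms(3,4) by simp
  obtain v where v: "v \<in> V" using V2 by fastforce
  have "B 0 \<subseteq> V \<times> V" using B(1)[of 0] assms(4) by auto
  then obtain f where f: "bij_betw f {..<card V} V"
    "\<And>i. i < card V \<Longrightarrow> (f i, f (Suc i mod card V)) \<in> B 0"
    using strong_functional_cycle[of V "B 0" v] full_strong_packing_single_valued[OF fam assms(2,3) V2, of 0]
      B(2)[of 0] assms(2,4) V2 v by (metis less_eq_Suc_le One_nat_def)
  \<comment> \<open>Relabels each vertex by its position on the cycle found in class 0.\<close>
  define g where "g = the_inv_into {..m} f"
  have f': "bij_betw f {..m} V" using f(1) assms(3) by (simp add: lessThan_Suc_atMost)
  then have g: "bij_betw g V {..m}" unfolding g_def by (rule bij_betw_the_inv_into)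
  have gf: "g (f i) = i" if "i \<le> m" for i
    unfolding g_def using f' that by (simp add: the_inv_into_f_f bij_betw_def)
  define C where "C i = map_prod g g ` B i" for i
  have injg: "inj_on g V" and img: "g ` V = {..m}" using g by (simp_all add: bij_betw_def)
  have famC: "strong_family {..m} m C"
    using strong_family_image[OF injg fam] by (simp add: C_def[abs_def] img)
  note C1 = strong_familyD(1)[OF famC] and C2 = strong_familyD(2)[OF famC]
    and C3 = strong_familyD(3)[OF famC]
  have base: "(i, Suc i mod Suc m) \<in> C 0" if "i \<le> m" for i
  proof -
    have "map_prod g g (f i, f (Suc i mod Suc m)) \<in> C 0"
      unfolding C_def using f(2)[of i] that assms(3) by (intro imageI) simp
    then show ?thesis using gf[OF that] gf[of "Suc i mod Suc m"] mod_less_divisor[of "Suc m" "Suc i"]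
      by (simp add: less_Suc_eq_le)
  qed
  have W: "finite {..m}" "card {..m} = Suc m" "2 \<le> card {..m}" using assms(4) by simp_all
  obtain h where h: "h ` {..<m} = {..m} - {0}" "\<And>i y. i < m \<Longrightarrow> (0, y) \<in> C i \<longleftrightarrow> y = h i"
    using full_strong_packing_heads[OF famC W, of 0] by auto
  have "\<exists>i<m. h i = y" if "y \<in> {1..m}" for y
  proof -
    have "y \<in> h ` {..<m}" using that unfolding h(1) by auto
    then show ?thesis by auto
  qed
  \<comment> \<open>\<open>c y\<close> is the class that contains the arc from \<open>0\<close> to
    \<open>y\<close>.\<close>
  then obtain c where c: "\<And>y. y \<in> {1..m} \<Longrightarrow> c y < m \<and> h (c y) = y" by metis
  have "\<exists>k. bij_betw k {..m} {..m} \<and> k 0 = 0 \<and> k 1 = y \<and>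
      (\<forall>i\<le>m. (k i, k (Suc i mod Suc m)) \<in> C (c y)) \<and> (y = 1 \<longrightarrow> k = id)" if y: "y \<in> {1..m}" for y
  proof (cases "y = 1")
    case True
    \<comment> \<open>The arc from \<open>0\<close> to \<open>1\<close> belongs to the normalised
      cycle, so its class is class 0 and the identity can serve as \<open>k\<close>.\<close>
    have "h 0 = 1" using h(2)[of 0 1] base[of 0] assms(4) by simp
    then have "(0, 1) \<in> C (c 1) \<inter> C 0" using h(2) c[of 1] assms(4) by simp
    then have "c 1 = 0" using C3[of "c 1" 0] c[of 1] assms(4) by fastforce
    then show ?thesis using base True by (intro exI[of _ id]) simp
  next
    case False
    have cy: "c y < m" "h (c y) = y" using c[OF y] by auto
    have "single_valued (C (c y))"
      using full_strong_packing_single_valued[OF famC W cy(1)] by simp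
    moreover have "C (c y) \<subseteq> {..m} \<times> {..m}" using C1[OF cy(1)] by auto
    ultimately obtain k where k: "bij_betw k {..<card {..m}} {..m}" "k 0 = 0"
        "\<And>i. i < card {..m} \<Longrightarrow> (k i, k (Suc i mod card {..m})) \<in> C (c y)"
      using strong_functional_cycle[OF C2[OF cy(1)] _ _ W(1,3), of 0] by blast
    have "(0, k 1) \<in> C (c y)" using k(3)[of 0] k(2) assms(4) by simp
    then have "k 1 = y" using h(2)[OF cy(1)] cy(2) by simp
    then show ?thesis using k False
      by (intro exI[of _ k]) (simp add: lessThan_Suc_atMost less_Suc_eq_le)
  qed
  then obtain k where k: "\<And>y. y \<in> {1..m} \<Longrightarrow> bij_betw (k y) {..m} {..m} \<and> k y 0 = 0 \<and> k y 1 = y \<and>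
      (\<forall>i\<le>m. (k y i, k y (Suc i mod Suc m)) \<in> C (c y)) \<and> (y = 1 \<longrightarrow> k y = id)"
    by metis
  have sub: "set (cycle_arcs (map (k y) [0..<Suc m])) \<subseteq> C (c y)" if "y \<in> {1..m}" for y
    unfolding cycle_arcs_map[OF zero_less_Suc] using k[OF that] by (auto simp: less_Suc_eq_le)
  show thesis
  proof (rule that[of k])
    show "bij_betw (k y) {..m} {..m} \<and> k y 0 = 0 \<and> k y 1 = y" if "y \<in> {1..m}" for y
      using k[OF that] by blast
    show "k 1 = id" using k[of 1] assms(4) by simp
    show "arcs_disjoint (map (k y) [0..<Suc m]) (map (k z) [0..<Suc m])"
      if yz: "y \<in> {1..m}" "z \<in> {1..m}" "y \<noteq> z" for y z
    proof -
      have "c y \<noteq> c z" using c[OF yz(1)] c[OF yz(2)] yz(3) by metis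
      then have "C (c y) \<inter> C (c z) = {}" using C3 c yz by blast
      then show ?thesis using sub[OF yz(1)] sub[OF yz(2)] unfolding arcs_disjoint_def by blast
    qed
  qed
qed

text \<open>Already the cycle starting \<open>0, 2\<close> fails: \<open>0, 2, 1, 3\<close> repeats
  the arc from \<open>3\<close> to \<open>0\<close> of the normalised cycle, and
  \<open>0, 2, 3, 1\<close> the arc from \<open>2\<close> to \<open>3\<close>.\<close>

lemma no_full_strong_packing_4:
  assumes "finite V" "card V = 4"
  shows "\<not> strong_packing V 3"
proof
  assume "strong_packing V 3"
  then obtain f where bij: "\<And>y. y \<in> {1..3} \<Longrightarrow> bij_betw (f y) {..3} {..3} \<and> f y 0 = 0 \<and> f y 1 = y"
    and disj: "\<And>y z. y \<in> {1..3} \<Longrightarrow> z \<in> {1..3} \<Longrightarrow> y \<noteq> z \<Longrightarrow>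
      arcs_disjoint (map (f y) [0..<Suc 3]) (map (f z) [0..<Suc 3])"
    and f1: "f 1 = id"
    using full_strong_packing_cycles[of V 3] assms by auto
  have f2: "bij_betw (f 2) {..3} {..3}" "f 2 0 = 0" "f 2 1 = 2" using bij[of 2] by auto
  have "f 2 2 \<le> 3" "f 2 3 \<le> 3" using f2(1) by (auto simp: bij_betw_def)
  moreover have "f 2 i \<noteq> f 2 j" if "i < j" "j \<le> 3" for i j
    using bij_betw_imp_inj_on[OF f2(1)] inj_onD[of "f 2" "{..3}" i j] that by auto
  from this[of 0 2] this[of 0 3] this[of 1 2] this[of 1 3] this[of 2 3]
  have "f 2 2 \<notin> {0, 2, f 2 3}" "f 2 3 \<notin> {0, 2}" using f2(2,3) by auto
  ultimately have "f 2 2 = 1 \<and> f 2 3 = 3 \<or> f 2 2 = 3 \<and> f 2 3 = 1" by auto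
  moreover have "arcs_disjoint [0, 1, 2, 3] [0, 2, f 2 2, f 2 3]"
    using disj[of 1 2] f1 f2 by (simp add: upt_rec numeral_eq_Suc)
  ultimately show False by (auto simp: arcs_disjoint_def cycle_arcs_def)
qed

lemma no_full_strong_packing_6:
  assumes "finite V" "card V = 6"
  shows "\<not> strong_packing V 5"
proof
  assume "strong_packing V 5"
  then obtain f where bij: "\<And>y. y \<in> {1..5} \<Longrightarrow> bij_betw (f y) {..5} {..5} \<and> f y 0 = 0 \<and> f y 1 = y"
    and disj: "\<And>y z. y \<in> {1..5} \<Longrightarrow> z \<in> {1..5} \<Longrightarrow> y \<noteq> z \<Longrightarrow>
      arcs_disjoint (map (f y) [0..<Suc 5]) (map (f z) [0..<Suc 5])"
    and f1: "f 1 = id"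
    using full_strong_packing_cycles[of V 5] assms by auto
  have upt: "[0..<Suc 5] = [0, 1, 2, 3, 4, 5::nat]" by (simp add: upt_rec numeral_eq_Suc)
  have mem: "map (f y) [0..<Suc 5] \<in> set (six_cycles y)" if y: "y \<in> {2..5}" for y
  proof -
    have f: "inj_on (f y) {..5}" "f y ` {..5} = {..5}" "f y 0 = 0" "f y 1 = y"
      using bij[of y] y by (auto simp: bij_betw_def)
    have in1: "f y i \<in> set [1..<6]" if "i \<in> {1..5}" for i
    proof -
      have "f y i \<noteq> f y 0" using inj_onD[OF f(1), of i 0] that by auto
      moreover have "f y i \<le> 5" using f(2) that by auto
      ultimately show ?thesis using f(3) by auto
    qed
    have ne: "f y i \<noteq> f y j" if "i < j" "j \<le> 5" for i j
      using inj_onD[OF f(1), of i j] that by auto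
    have "[0, y, f y 2, f y 3, f y 4, f y 5] \<in> set [[0, y, a, b, c, d].
      a \<leftarrow> filter (\<lambda>a. a \<noteq> y) [1..<6],
      b \<leftarrow> filter (\<lambda>b. b \<notin> {y, a}) [1..<6],
      c \<leftarrow> filter (\<lambda>c. c \<notin> {y, a, b}) [1..<6],
      d \<leftarrow> filter (\<lambda>d. d \<notin> {y, a, b, c}) [1..<6]]"
      using in1[of 2] in1[of 3] in1[of 4] in1[of 5] f(4)
        ne[of 1 2] ne[of 1 3] ne[of 1 4] ne[of 1 5] ne[of 2 3] ne[of 2 4] ne[of 2 5] ne[of 3 4]
        ne[of 3 5] ne[of 4 5]
      by (auto simp: image_iff)
    moreover have "arcs_disjoint [0..<6] (map (f y) [0..<Suc 5])"
      using disj[of 1 y] y f1 by simp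
    moreover have "map (f y) [0..<Suc 5] = [0, y, f y 2, f y 3, f y 4, f y 5]"
      unfolding upt using f(3,4) by simp
    ultimately show ?thesis by (simp only: six_cycles_def set_filter mem_Collect_eq simp_thms)
  qed
  have d: "arcs_disjoint (map (f y) [0..<Suc 5]) (map (f z) [0..<Suc 5])"
    if "y \<in> {2..5}" "z \<in> {2..5}" "y \<noteq> z" for y z
    using disj[of y z] that by auto
  show False
    by (rule six_cycles_clash[OF mem mem mem mem d d d d d d]) simp_all
qed

section \<open>Complete digraphs and the extremal case\<close>

lemma strong_complete: "strong V (V \<times> V - Id)"
  unfolding strong_def by (metis DiffI IdE SigmaI r_into_rtrancl rtrancl.rtrancl_refl pair_in_Id_conv)

text \<open>Odd orders \<open>2 * t + 1\<close> come from the zigzag, even orders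
  \<open>2 * t + 2\<close> with \<open>3 \<le> t\<close> from its extension. For order 2 the
  complete digraph itself is the single class.\<close>

lemma full_strong_packing:
  assumes "finite V" "2 \<le> card V" "card V \<notin> {4, 6}"
  shows "strong_packing V (card V - 1)"
proof (cases "odd (card V)")
  case True
  define t where "t = int (card V div 2)"
  have t: "0 < t" "nat (2 * t) = card V - 1" "card {0..2 * t} = card V"
    using True assms(2) by (auto simp: t_def elim!: oddE)
  then have "strong_packing {0..2 * t} (card V - 1)"
    using walecki_family[of t] unfolding strong_packing_def by metis
  then show ?thesis using strong_packing_card t(3) assms(1) by (metis finite_atLeastAtMost_int)
next
  case even: False
  show ?thesis
  proof (cases "card V = 2")
    case True
    have "strong_family V (card V - 1) (\<lambda>_. V \<times> V - Id)"
      by (rule strong_familyI) (use True strong_complete in auto)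
    then show ?thesis unfolding strong_packing_def by blast
  next
    case False
    define t where "t = int (card V div 2) - 1"
    have "8 \<le> card V" using False even assms(2,3) by simp presburger
    then have t: "3 \<le> t" "Suc (nat (2 * t)) = card V - 1" "card {0..2 * t + 1} = card V"
      using even by (auto simp: t_def elim!: evenE)
    then have "strong_packing {0..2 * t + 1} (card V - 1)" using strong_packing_even[of t] by simp
    then show ?thesis using strong_packing_card t(3) assms(1) by (metis finite_atLeastAtMost_int)
  qed
qed

text \<open>Containing all of \<open>V\<close> forces every subgraph to span.\<close>

lemma strong_packing_if_packing:
  assumes "packing V (V \<times> V - Id) V m"
  shows "strong_packing V m"
proof -
  obtain H where H: "\<And>i. i < m \<Longrightarrow> strong_subgraph_containing V (V \<times> V - Id) V (H i)"
    and D: "\<And>i j. i < m \<Longrightarrow> j < m \<Longrightarrow> i \<noteq> j \<Longrightarrow> snd (H i) \<inter> snd (H j) = {}"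
    using assms unfolding packing_def by blast
  have "snd (H i) \<subseteq> V \<times> V - Id \<and> strong V (snd (H i))" if "i < m" for i
  proof -
    have "fst (H i) = V" using H[OF that] by (auto simp: strong_subgraph_containing_def)
    then show ?thesis using H[OF that] by (simp add: strong_subgraph_containing_def)
  qed
  then have "strong_family V m (\<lambda>i. snd (H i))" using D by (intro strong_familyI) simp_all
  then show ?thesis unfolding strong_packing_def by blast
qed

lemma digraph_complete: "finite V \<Longrightarrow> digraph V (V \<times> V - Id)"
  unfolding digraph_def by auto

lemma lambda_k_complete_iff:
  assumes V: "finite V" and k: "2 \<le> k" "k \<le> card V"
  shows "lambda_k V (V \<times> V - Id) k = card V - 1 \<longleftrightarrow> k \<notin> {4, 6} \<or> k < card V"
proof
  let ?A = "V \<times> V - Id"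
  have fin: "finite ?A" using V by simp
  show "k \<notin> {4, 6} \<or> k < card V" if eq: "lambda_k V ?A k = card V - 1"
  proof (rule ccontr)
    assume "\<not> (k \<notin> {4, 6} \<or> k < card V)"
    then have c: "card V = k" "k = 4 \<or> k = 6" using k(2) by auto
    have "2 \<le> card V" using k by simp
    note p = packing_lambda_S[OF fin this, of V]
    have "card V - 1 \<le> lambda_S V ?A V"
      using lambda_k_le[OF V k(2), of V ?A] eq c(1) by simp
    moreover have "lambda_S V ?A V \<le> card V - 1"
    proof -
      obtain v where v: "v \<in> V" using k by fastforce
      have "?A `` {v} = V - {v}" using v by auto
      then show ?thesis using lambda_S_le_outdegree[OF fin \<open>2 \<le> card V\<close> v, of V] v V by simp
    qed
    ultimately have "strong_packing V (card V - 1)" using p strong_packing_if_packing by simp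
    then show False using no_full_strong_packing_4[OF V] no_full_strong_packing_6[OF V] c by auto
  qed
  show "lambda_k V ?A k = card V - 1" if H: "k \<notin> {4, 6} \<or> k < card V"
  proof (rule antisym[OF lambda_k_le_order[OF digraph_complete[OF V] k]])
    obtain S where S: "S \<subseteq> V" "card S = k" "lambda_k V ?A k = lambda_S V ?A S"
      using lambda_k_attained[OF V k(2)] by blast
    have "packing V ?A S (card V - 1)"
    proof (cases "card V \<in> {4, 6}")
      case False
      then show ?thesis using packing_if_strong_packing[OF full_strong_packing[OF V]] S(1) k by simp
    next
      case True
      \<comment> \<open>In the exceptional orders some vertex \<open>a\<close> lies outside
        \<open>S\<close>; deleting it leaves order 3 or 5, where the zigzag applies, and the star at
        \<open>a\<close> makes up for the lost subgraph.\<close>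
      then have "card S < card V" using H S(2) k(2) by auto
      then have "S \<noteq> V" by auto
      then obtain a where a: "a \<in> V" "a \<notin> S" using S(1) by blast
      have c: "card (V - {a}) = card V - 1" using a V by simp
      have "strong_packing (V - {a}) (card (V - {a}) - 1)"
        by (rule full_strong_packing) (use True V c in auto)
      moreover have "S \<subseteq> V - {a}" using a(2) S(1) by blast
      ultimately show ?thesis using packing_star[OF _ refl a(1)] True by (fastforce simp: c)
    qed
    then show "card V - 1 \<le> lambda_k V ?A k" using lambda_S_ge[OF fin] S k(1) by metis
  qed
qed

lemma digraph_iso_complete_iff:
  assumes "digraph V A"
  shows "digraph_iso V A (complete_digraph_V (card V)) (complete_digraph_A (card V)) \<longleftrightarrow>
    A = V \<times> V - Id"
proof
  assume "digraph_iso V A (complete_digraph_V (card V)) (complete_digraph_A (card V))"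
  then obtain f where bij: "bij_betw f V {0..<card V}"
    and iso: "\<forall>u\<in>V. \<forall>v\<in>V. (u, v) \<in> A \<longleftrightarrow> (f u, f v) \<in> complete_digraph_A (card V)"
    unfolding digraph_iso_def complete_digraph_V_def by (elim exE conjE)
  note f = bij_betw_imp_inj_on[OF bij] bij_betw_imp_surj_on[OF bij] iso[rule_format]
  have lt: "f u < card V" if "u \<in> V" for u using f(2) that by auto
  have "(u, v) \<in> A \<longleftrightarrow> u \<noteq> v" if "u \<in> V" "v \<in> V" for u v
    using f(3)[OF that] lt[OF that(1)] lt[OF that(2)] inj_on_eq_iff[OF f(1) that]
    by (simp add: complete_digraph_A_def)
  moreover have "A \<subseteq> V \<times> V" using assms by (simp add: digraph_def)
  ultimately show "A = V \<times> V - Id" by auto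
next
  assume A: "A = V \<times> V - Id"
  have "finite V" using assms by (simp add: digraph_def)
  then obtain f where f: "bij_betw f V {0..<card V}" using ex_bij_betw_finite_nat by blast
  have "(u, v) \<in> A \<longleftrightarrow> (f u, f v) \<in> complete_digraph_A (card V)" if "u \<in> V" "v \<in> V" for u v
  proof -
    have "f u < card V" "f v < card V" using f that by (auto simp: bij_betw_def)
    then show ?thesis using that A inj_on_eq_iff[OF bij_betw_imp_inj_on[OF f] that]
      by (simp add: complete_digraph_A_def)
  qed
  then show "digraph_iso V A (complete_digraph_V (card V)) (complete_digraph_A (card V))"
    unfolding digraph_iso_def complete_digraph_V_def using f by blast
qed

section \<open>Sharpness of the lower bound\<close>

definition directed_cycle :: "nat \<Rightarrow> (nat \<times> nat) set" where
  "directed_cycle n = (\<lambda>i. (i, Suc i mod n)) ` {..<n}"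

lemma directed_cycle_digraph:
  assumes "2 \<le> n"
  shows "digraph {0..<n} (directed_cycle n)"
proof -
  have "Suc i mod n \<noteq> i" if "i < n" for i
    using that assms by (cases "Suc i = n") auto
  moreover have "Suc i mod n < n" for i using assms by simp
  ultimately show ?thesis unfolding digraph_def directed_cycle_def by fastforce
qed

lemma directed_cycle_strong:
  assumes "2 \<le> n"
  shows "strong {0..<n} (directed_cycle n)"
proof (rule strongI_hub[of _ 0])
  fix v assume v: "v \<in> {0..<n}"
  have arc: "(i, Suc i) \<in> directed_cycle n" if "Suc i < n" for i
    using that by (auto simp: directed_cycle_def intro!: image_eqI[of _ _ i])
  have chain: "(i, j) \<in> (directed_cycle n)\<^sup>*" if "i \<le> j" "j < n" for i j
    by (rule rtrancl_chain[of i j "\<lambda>i. i", OF arc that(1)]) (use that in simp)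
  have wrap: "(n - 1, 0) \<in> directed_cycle n"
    using assms by (auto simp: directed_cycle_def intro!: image_eqI[of _ _ "n - 1"])
  have "v \<le> n - 1" "n - 1 < n" using v by auto
  then show "(0, v) \<in> (directed_cycle n)\<^sup>* \<and> (v, 0) \<in> (directed_cycle n)\<^sup>*"
    using chain[of 0 v] rtrancl_into_rtrancl[OF chain wrap] v by simp
qed

text \<open>Outdegree one caps the value, and strength keeps it from being 0.\<close>

lemma lambda_k_directed_cycle:
  assumes "2 \<le> k" "k \<le> n"
  shows "lambda_k {0..<n} (directed_cycle n) k = 1"
proof -
  have n: "2 \<le> n" "k \<le> card {0..<n}" using assms by auto
  have "directed_cycle n `` {0} \<subseteq> {Suc 0 mod n}" by (auto simp: directed_cycle_def)
  then have "card (directed_cycle n `` {0}) \<le> 1" using card_mono[of "{Suc 0 mod n}"] by simp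
  moreover have "lambda_k {0..<n} (directed_cycle n) k \<le> card (directed_cycle n `` {0})"
    using n by (intro lambda_k_le_outdegree directed_cycle_digraph assms) auto
  moreover have "1 \<le> lambda_k {0..<n} (directed_cycle n) k"
    using n by (intro lambda_k_ge_one directed_cycle_digraph directed_cycle_strong assms)
  ultimately show ?thesis by simp
qed

theorem theorem3p6:
  fixes V :: "'a set" and A :: "('a \<times> 'a) set" and n k :: nat
  assumes "digraph V A" and "strong V A" and "card V = n"
    and "2 \<le> k" and "k \<le> n"
  shows "1 \<le> lambda_k V A k \<and> lambda_k V A k \<le> n - 1
    \<and> (\<exists>(W :: nat set) B. digraph W B \<and> strong W B \<and> card W = n \<and> lambda_k W B k = 1)
    \<and> ((k \<notin> {4, 6} \<or> k < n) \<longrightarrow>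
         (\<exists>(W :: nat set) B. digraph W B \<and> strong W B \<and> card W = n \<and> lambda_k W B k = n - 1))
    \<and> (lambda_k V A k = n - 1 \<longleftrightarrow>
         digraph_iso V A (complete_digraph_V n) (complete_digraph_A n)
         \<and> (k \<notin> {4, 6} \<or> (k \<in> {4, 6} \<and> k < n)))"
proof (intro conjI)
  have V: "finite V" and kV: "k \<le> card V" using assms by (simp_all add: digraph_def)
  show "1 \<le> lambda_k V A k" using lambda_k_ge_one[OF assms(1,2,4) kV] .
  show "lambda_k V A k \<le> n - 1" using lambda_k_le_order[OF assms(1,4) kV] assms(3) by simp
  have n: "2 \<le> n" using assms by simp
  show "\<exists>(W :: nat set) B. digraph W B \<and> strong W B \<and> card W = n \<and> lambda_k W B k = 1"
    using directed_cycle_digraph[OF n] directed_cycle_strong[OF n]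
      lambda_k_directed_cycle[OF assms(4,5)]
    by (intro exI[of _ "{0..<n}"] exI[of _ "directed_cycle n"]) simp
  show "(k \<notin> {4, 6} \<or> k < n) \<longrightarrow>
      (\<exists>(W :: nat set) B. digraph W B \<and> strong W B \<and> card W = n \<and> lambda_k W B k = n - 1)"
  proof
    assume "k \<notin> {4, 6} \<or> k < n"
    then have "lambda_k {0..<n} ({0..<n} \<times> {0..<n} - Id) k = n - 1"
      using lambda_k_complete_iff[of "{0..<n}" k] assms(4,5) by simp
    then show "\<exists>(W :: nat set) B. digraph W B \<and> strong W B \<and> card W = n \<and> lambda_k W B k = n - 1"
      using digraph_complete[of "{0..<n}"] strong_complete[of "{0..<n}"]
      by (intro exI[of _ "{0..<n}"] exI[of _ "{0..<n} \<times> {0..<n} - Id"]) simp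
  qed
  have iso: "digraph_iso V A (complete_digraph_V n) (complete_digraph_A n) \<longleftrightarrow> A = V \<times> V - Id"
    using digraph_iso_complete_iff[OF assms(1)] assms(3) by simp
  \<comment> \<open>Extremality forces completeness first, which reduces the equivalence to the
    complete digraph.\<close>
  have "lambda_k V A k = n - 1 \<longleftrightarrow> A = V \<times> V - Id \<and> (k \<notin> {4, 6} \<or> k < n)"
    using lambda_k_extremal_complete[OF assms(1,4) kV] lambda_k_complete_iff[OF V assms(4) kV] assms(3)
    by metis
  then show "lambda_k V A k = n - 1 \<longleftrightarrow>
      digraph_iso V A (complete_digraph_V n) (complete_digraph_A n)
      \<and> (k \<notin> {4, 6} \<or> (k \<in> {4, 6} \<and> k < n))"
    unfolding iso by blast
qed

end
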